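(* Let $m\ge 3$ and let $LP_{1,m}=K_1(u_1)+\langle v_1,\dots,v_m\rangle$ be a long brush graph of diameter $2$ with $\langle v_1,\dots,v_m\rangle=K_{m_1}\cup K_{m_2}\cup\dots\cup K_{m_x}$ (disjoint union of complete graphs), where $x\ge2$, $1\le m_1\le m_2\le\dots\le m_x$, $m_1+m_2+\dots+m_x=m$, $m_1+m_2\ge 3$ and $m_1,\dots,m_x,x\in\mathbb{N}$. Then $LP_{1,m}$ is $2$-distance magic if and only if there exists $j$ with $1\le j\le m+1$ such that $J_{m+1}\setminus\{j\}$ can be partitioned into $x$ sets $S_1,\dots,S_x$ with $|S_i|=m_i$ for each $i$ and $\sum_{s\in S_1}s=\sum_{s\in S_2}s=\dots=\sum_{s\in S_x}s$ (with $u_1$ labeled $j$).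
   Context: $J_n=\{1,2,\dots,n\}$. All graphs are finite, simple and undirected; $d(u,v)$ is graph distance. For $u\in V(G)$ and $k\in\mathbb{N}$, $\partial N_k(u)=\{v\in V(G): d(u,v)=k\}$. For a graph $G$ of order $p\ge3$, a $k$-distance magic labeling is a bijection $f:V(G)\to J_p$ together with a constant $M$ such that $\sum_{w\in\partial N_k(u)} f(w)=M$ for every vertex $u$ with $\partial N_k(u)\neq\emptyset$, and $G$ has at least one pair of vertices at distance $k$; $G$ is $k$-distance magic if it has such a labeling. The long brush $LP_{1,m}$ has vertex set $\{u_1,v_1,\dots,v_m\}$, $u_1$ adjacent to every $v_i$, plus some edges among $v_1,\dots,v_m$; $K_1(u_1)+H$ denotes the join of the single vertex $u_1$ with the graph $H$, and $\langle v_1,\dots,v_m\rangle$ is the induced subgraph on $\{v_1,\dots,v_m\}$. *)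

theory Defs
  imports
    "Graph_Theory.Kuratowski"
    "Graph_Theory.Shortest_Path"
    "HOL-Library.Disjoint_Sets"
begin

text \<open>
  A finite simple undirected graph is a \<^locale>\<open>pair_graph\<close>: a loop-free symmetric digraph on a
  finite vertex set whose arcs are pairs of vertices.
\<close>

text \<open>
  With every arc of cost \<open>1\<close>, the cost of a walk is its length; vertices that are not joined by
  a walk have distance \<open>\<infinity>\<close>.
\<close>

definition graph_dist :: "'a pair_pre_digraph \<Rightarrow> 'a \<Rightarrow> 'a \<Rightarrow> ereal" where
  "graph_dist G u v = wf_digraph.\<mu> (with_proj G) (\<lambda>_. 1) u v"

definition graph_diameter :: "'a pair_pre_digraph \<Rightarrow> ereal" where
  "graph_diameter G = (SUP u\<in>pverts G. SUP v\<in>pverts G. graph_dist G u v)"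

definition dist_nbhd :: "'a pair_pre_digraph \<Rightarrow> nat \<Rightarrow> 'a \<Rightarrow> 'a set" where
  "dist_nbhd G k u = {v \<in> pverts G. graph_dist G u v = ereal (real k)}"

definition distance_magic_labeling ::
  "nat \<Rightarrow> 'a pair_pre_digraph \<Rightarrow> ('a \<Rightarrow> nat) \<Rightarrow> nat \<Rightarrow> bool" where
  "distance_magic_labeling k G f M \<longleftrightarrow>
     3 \<le> card (pverts G) \<and>
     (\<exists>u\<in>pverts G. \<exists>v\<in>pverts G. graph_dist G u v = ereal (real k)) \<and>
     bij_betw f (pverts G) {1..card (pverts G)} \<and>
     (\<forall>u\<in>pverts G. dist_nbhd G k u \<noteq> {} \<longrightarrow> (\<Sum>w\<in>dist_nbhd G k u. f w) = M)"

definition distance_magic :: "nat \<Rightarrow> 'a pair_pre_digraph \<Rightarrow> bool" where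
  "distance_magic k G \<longleftrightarrow> (\<exists>f M. distance_magic_labeling k G f M)"

definition graph_K1 :: "'a \<Rightarrow> 'a pair_pre_digraph" where
  "graph_K1 u = \<lparr> pverts = {u}, parcs = {} \<rparr>"

text \<open>The join is meant for graphs with disjoint vertex sets.\<close>

definition graph_join ::
  "'a pair_pre_digraph \<Rightarrow> 'a pair_pre_digraph \<Rightarrow> 'a pair_pre_digraph" where
  "graph_join G H =
     \<lparr> pverts = pverts G \<union> pverts H,
       parcs = parcs G \<union> parcs H \<union> pverts G \<times> pverts H \<union> pverts H \<times> pverts G \<rparr>"

text \<open>
  The vertices are \<open>u, v 1, \<dots>, v m\<close>; the edges among \<open>v 1, \<dots>, v m\<close> are arbitrary.
\<close>

definition long_brush :: "nat \<Rightarrow> 'a \<Rightarrow> (nat \<Rightarrow> 'a) \<Rightarrow> 'a pair_pre_digraph \<Rightarrow> bool" where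
  "long_brush m u v G \<longleftrightarrow>
     pair_graph G \<and>
     inj_on v {1..m} \<and> u \<notin> v ` {1..m} \<and>
     pverts G = insert u (v ` {1..m}) \<and>
     (\<forall>i\<in>{1..m}. (u, v i) \<in> parcs G)"

definition disjoint_union_of_complete ::
  "nat \<Rightarrow> (nat \<Rightarrow> nat) \<Rightarrow> 'a pair_pre_digraph \<Rightarrow> bool" where
  "disjoint_union_of_complete x ms H \<longleftrightarrow>
     (\<exists>C :: nat \<Rightarrow> 'a pair_pre_digraph.
        (\<forall>i\<in>{1..x}. K\<^bsub>ms i\<^esub> (with_proj (C i))) \<and>
        disjoint_family_on (\<lambda>i. pverts (C i)) {1..x} \<and>
        with_proj H = pre_digraph.Union (with_proj H) ((\<lambda>i. with_proj (C i)) ` {1..x}))"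

definition equal_sum_partition ::
  "nat \<Rightarrow> (nat \<Rightarrow> nat) \<Rightarrow> nat set \<Rightarrow> (nat \<Rightarrow> nat set) \<Rightarrow> bool" where
  "equal_sum_partition x ms A S \<longleftrightarrow>
     (\<Union>i\<in>{1..x}. S i) = A \<and>
     disjoint_family_on S {1..x} \<and>
     (\<forall>i\<in>{1..x}. card (S i) = ms i) \<and>
     (\<forall>i\<in>{1..x}. \<forall>i'\<in>{1..x}. \<Sum>(S i) = \<Sum>(S i'))"

end

theory Submission
  imports Defs
begin

text \<open>
  Every \<open>v i\<close> is adjacent to \<open>u\<close>, and two vertices of different cliques have distance \<open>2\<close> through
  \<open>u\<close>. Hence \<open>u\<close> has no vertex at distance \<open>2\<close>, while for a vertex of a clique \<open>W\<close> those at
  distance \<open>2\<close> form the complement of \<open>W\<close> in the union \<open>V\<close> of the cliques. Their labels sum to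
  the sum over \<open>V\<close> minus the sum over \<open>W\<close>, which is the same for all cliques iff the
  label sets of the cliques have equal sums.
\<close>

text \<open>With unit costs the distance is an infimum of walk lengths, hence of integers. So it
  equals 2 exactly when some walk has length at most 2 and none is shorter than 2; walks of length
  0, 1 and 2 are an equality, an arc and a common neighbour.\<close>

lemma graph_dist_eq_2_iff:
  assumes "pair_wf_digraph G"
  shows "graph_dist G a b = ereal 2 \<longleftrightarrow>
    a \<noteq> b \<and> (a, b) \<notin> parcs G \<and> (\<exists>c. (a, c) \<in> parcs G \<and> (c, b) \<in> parcs G)"
proof -
  interpret pair_wf_digraph G by fact
  have cost: "awalk_cost (\<lambda>_. 1) p = real (length p)" for p :: "('a \<times> 'a) list"
    by (induction p) auto
  have dist: "graph_dist G a b = (INF p\<in>{p. awalk a p b}. ereal (real (length p)))"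
    by (simp add: graph_dist_def \<mu>_def cost)
  have le: "graph_dist G a b \<le> ereal (real (length p))" if "awalk a p b" for p
    unfolding dist using that by (auto intro: INF_lower)
  have walk2: "awalk a [(a, c), (c, b)] b" if "(a, c) \<in> parcs G" "(c, b) \<in> parcs G" for c
    using that in_arcsD2 by (auto simp: awalk_simps)
  show ?thesis
  proof (intro iffI conjI)
    assume d: "graph_dist G a b = ereal 2"
    obtain p where p: "awalk a p b" "length p \<le> 2"
    proof -
      \<comment> \<open>Otherwise 3 is a lower bound for all walk lengths and hence for the infimum.
        This includes the case of no walk at all, where the infimum is infinite.\<close>
      have "\<exists>p. awalk a p b \<and> length p \<le> 2"
      proof (rule ccontr)
        assume "\<not> ?thesis"
        then have "ereal 3 \<le> graph_dist G a b"
          unfolding dist by (intro INF_greatest) (fastforce simp: not_le)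
        then show False using d by simp
      qed
      then show ?thesis using that by blast
    qed
    show ne: "a \<noteq> b"
    proof
      assume "a = b"
      \<comment> \<open>The empty walk requires \<open>a\<close> to be a vertex, which
        \<open>p\<close> provides; it bounds the distance by 0.\<close>
      then have "awalk a [] b" using p(1) by (simp add: awalk_Nil_iff awalk_hd_in_verts)
      then show False using le[of "[]"] d by simp
    qed
    show nadj: "(a, b) \<notin> parcs G"
    proof
      assume "(a, b) \<in> parcs G"
      then have "awalk a [(a, b)] b" using in_arcsD2 by (auto simp: awalk_simps)
      then show False using le[of "[(a, b)]"] d by simp
    qed
    show "\<exists>c. (a, c) \<in> parcs G \<and> (c, b) \<in> parcs G"
    proof (cases p)
      case Nil
      then show ?thesis using p ne by (simp add: awalk_simps)
    next
      case (Cons e q)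
      show ?thesis
      proof (cases q)
        case Nil
        then show ?thesis using p Cons nadj by (cases e) (auto simp: awalk_simps)
      next
        case (Cons e' q')
        then have "p = [e, e']" using p \<open>p = e # q\<close> by simp
        then show ?thesis using p by (cases e; cases e') (auto simp: awalk_simps)
      qed
    qed
  next
    assume *: "a \<noteq> b \<and> (a, b) \<notin> parcs G \<and> (\<exists>c. (a, c) \<in> parcs G \<and> (c, b) \<in> parcs G)"
    show "graph_dist G a b = ereal 2"
    proof (rule antisym)
      obtain c where "(a, c) \<in> parcs G" "(c, b) \<in> parcs G" using * by blast
      from le[OF walk2[OF this]] show "graph_dist G a b \<le> ereal 2" by simp
    next
      have "2 \<le> length p" if "awalk a p b" for p
      proof (rule ccontr)
        assume "\<not> 2 \<le> length p"
        then consider "p = []" | e where "p = [e]"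
          by (cases p; cases "tl p") auto
        then show False
          using that * by cases (auto simp: awalk_simps)
      qed
      then show "ereal 2 \<le> graph_dist G a b"
        unfolding dist by (intro INF_greatest) simp
    qed
  qed
qed

text \<open>The blocks \<open>S i\<close> are the images of the \<open>W i\<close> under a labeling
  \<open>f\<close>. Since the sums over \<open>W i\<close> and \<open>V - W i\<close> add up to the
  sum over \<open>V\<close>, one is independent of \<open>i\<close> iff the other is.\<close>

lemma equal_sum_partition_iff_labeling:
  fixes W :: "nat \<Rightarrow> 'a set" and A :: "nat set"
  assumes fin: "\<And>i. i \<in> {1..x} \<Longrightarrow> finite (W i)"
    and card: "\<And>i. i \<in> {1..x} \<Longrightarrow> card (W i) = ms i"
    and pos: "\<And>i. i \<in> {1..x} \<Longrightarrow> 1 \<le> ms i"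
    and disj: "disjoint_family_on W {1..x}"
    and V: "V = (\<Union>i\<in>{1..x}. W i)"
  shows "(\<exists>S. equal_sum_partition x ms A S) \<longleftrightarrow>
    (\<exists>f M. bij_betw f V A \<and> (\<forall>i\<in>{1..x}. sum f (V - W i) = M))"
proof
  have finV: "finite V" using fin V by auto
  assume "\<exists>S. equal_sum_partition x ms A S"
  then obtain S where S: "(\<Union>i\<in>{1..x}. S i) = A" "disjoint_family_on S {1..x}"
      "\<And>i. i \<in> {1..x} \<Longrightarrow> card (S i) = ms i"
      "\<And>i k. i \<in> {1..x} \<Longrightarrow> k \<in> {1..x} \<Longrightarrow> \<Sum>(S i) = \<Sum>(S k)"
    unfolding equal_sum_partition_def by blast
  \<comment> \<open>Infinite sets have \<open>card\<close> 0, so \<open>1 \<le> ms i\<close> forces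
    \<open>S i\<close> to be finite.\<close>
  have "\<exists>g. bij_betw g (W i) (S i)" if "i \<in> {1..x}" for i
    using that fin card S(3) pos by (intro finite_same_card_bij)
      (auto intro!: card_ge_0_finite dest!: pos simp: Suc_le_eq)
  then obtain g where g: "\<And>i. i \<in> {1..x} \<Longrightarrow> bij_betw (g i) (W i) (S i)"
    by metis
  \<comment> \<open>The block containing \<open>a\<close>, unique by disjointness; it serves to glue
    the bijections \<open>g i\<close> into one map on \<open>V\<close>.\<close>
  define idx where "idx a = (SOME i. i \<in> {1..x} \<and> a \<in> W i)" for a
  have idx: "idx a = i" if "i \<in> {1..x}" "a \<in> W i" for a i
  proof -
    have "idx a \<in> {1..x} \<and> a \<in> W (idx a)"
      unfolding idx_def by (rule someI[of _ i]) (use that in simp)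
    then show ?thesis using disj that unfolding disjoint_family_on_def by blast
  qed
  define f where "f a = g (idx a) a" for a
  have f: "bij_betw f (W i) (S i)" if "i \<in> {1..x}" for i
  proof -
    have "f a = g i a" if "a \<in> W i" for a
      using idx[OF \<open>i \<in> {1..x}\<close> that] by (simp add: f_def)
    then show ?thesis using g[OF that] bij_betw_cong[of "W i" f "g i" "S i"] by simp
  qed
  have "inj_on f V"
  proof (rule inj_onI)
    fix a b assume ab: "a \<in> V" "b \<in> V" "f a = f b"
    then obtain i k where ik: "i \<in> {1..x}" "a \<in> W i" "k \<in> {1..x}" "b \<in> W k"
      using V by blast
    then have "f a \<in> S i" "f b \<in> S k"
      using f by (auto dest: bij_betw_apply)
    then have "f a \<in> S i \<inter> S k" using ab(3) by simp
    then have "i = k" using disjoint_family_onD[OF S(2) ik(1,3)] by auto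
    then show "a = b" using bij_betw_imp_inj_on[OF f[OF ik(1)]] ik ab(3) by (auto dest: inj_onD)
  qed
  moreover have "f ` V = A"
    using f unfolding V image_UN S(1)[symmetric] bij_betw_def by auto
  ultimately have bij: "bij_betw f V A" by (simp add: bij_betw_def)
  \<comment> \<open>\<open>S 1\<close> represents the common block sum. The subtraction on naturals
    is exact because \<open>W i\<close> lies in \<open>V\<close>.\<close>
  have "sum f (V - W i) = sum f V - \<Sum>(S 1)" if "i \<in> {1..x}" for i
  proof -
    have "sum f (W i) = \<Sum>(S i)"
      using f[OF that] sum.reindex_bij_betw[of f "W i" "S i" "\<lambda>s. s"] by simp
    also have "\<dots> = \<Sum>(S 1)" using S(4)[of i 1] that by simp
    finally have "sum f (W i) = \<Sum>(S 1)" .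
    moreover have "W i \<subseteq> V" using V that by blast
    ultimately show ?thesis using sum.subset_diff[of "W i" V f] finV by simp
  qed
  then show "\<exists>f M. bij_betw f V A \<and> (\<forall>i\<in>{1..x}. sum f (V - W i) = M)"
    using bij by blast
next
  have finV: "finite V" using fin V by auto
  assume "\<exists>f M. bij_betw f V A \<and> (\<forall>i\<in>{1..x}. sum f (V - W i) = M)"
  then obtain f M where f: "bij_betw f V A"
    and M: "\<And>i. i \<in> {1..x} \<Longrightarrow> sum f (V - W i) = M" by blast
  have inj: "inj_on f V" using f by (rule bij_betw_imp_inj_on)
  have sub: "W i \<subseteq> V" if "i \<in> {1..x}" for i using V that by blast
  have injW: "inj_on f (W i)" if "i \<in> {1..x}" for i
    using inj sub[OF that] by (rule inj_on_subset)
  have "\<Sum>(f ` W i) = sum f V - M" if "i \<in> {1..x}" for i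
    using sum.subset_diff[OF sub[OF that] finV, of f] M[OF that]
    by (simp add: sum.reindex[OF injW[OF that]])
  moreover have "(\<Union>i\<in>{1..x}. f ` W i) = A"
    using f V by (simp add: bij_betw_def image_UN)
  moreover have "disjoint_family_on (\<lambda>i. f ` W i) {1..x}"
    using disj inj sub unfolding disjoint_family_on_def
    by (metis image_empty inj_on_image_Int)
  moreover have "card (f ` W i) = ms i" if "i \<in> {1..x}" for i
    using card_image[OF injW[OF that]] card[OF that] by simp
  ultimately have "equal_sum_partition x ms A (\<lambda>i. f ` W i)"
    unfolding equal_sum_partition_def by simp
  then show "\<exists>S. equal_sum_partition x ms A S" by blast
qed

text \<open>Reduces the conditions at all vertices to one equation per clique. Two nonempty cliques
  make every \<open>V - W i\<close> nonempty, so the guard in the definition exempts only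
  \<open>u\<close>, and a pair at distance 2 exists.\<close>

lemma distance_magic_labeling_iff_clique_sums:
  fixes W :: "nat \<Rightarrow> 'a set"
  assumes wf: "pair_wf_digraph G"
    and verts: "pverts G = insert u V"
    and arcs: "parcs G = (\<Union>i\<in>{1..x}. {(a, b). a \<in> W i \<and> b \<in> W i \<and> a \<noteq> b}) \<union>
      {u} \<times> V \<union> V \<times> {u}"
    and V: "V = (\<Union>i\<in>{1..x}. W i)"
    and disj: "disjoint_family_on W {1..x}"
    and ne: "\<And>i. i \<in> {1..x} \<Longrightarrow> W i \<noteq> {}"
    and u: "u \<notin> V"
    and x: "2 \<le> x"
    and card: "card (pverts G) = n" "3 \<le> n"
  shows "distance_magic_labeling 2 G f M \<longleftrightarrow>
    bij_betw f (insert u V) {1..n} \<and> (\<forall>i\<in>{1..x}. sum f (V - W i) = M)"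
proof -
  have same: "i = k" if "i \<in> {1..x}" "k \<in> {1..x}" "a \<in> W i" "a \<in> W k" for i k a
    using disj that unfolding disjoint_family_on_def by blast
  have nbhd_u: "dist_nbhd G 2 u = {}"
    unfolding dist_nbhd_def using u arcs verts by (auto simp: graph_dist_eq_2_iff[OF wf])
  have nbhd: "dist_nbhd G 2 a = V - W i" if i: "i \<in> {1..x}" and a: "a \<in> W i" for i a
  proof -
    have aV: "a \<in> V" "a \<noteq> u" using i a V u by blast+
    \<comment> \<open>The arcs at \<open>u\<close> drop out, and by disjointness \<open>W i\<close>
      is the only clique that can contribute an arc at \<open>a\<close>.\<close>
    have adj: "(a, b) \<in> parcs G \<longleftrightarrow> b \<in> W i \<and> a \<noteq> b" if "b \<in> V" for b
    proof -
      have "b \<noteq> u" using that u by blast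
      then show ?thesis using i a aV same unfolding arcs by blast
    qed
    have "graph_dist G a b = ereal 2 \<longleftrightarrow> b \<notin> W i" if "b \<in> V" for b
      using that i a aV adj[OF that] unfolding graph_dist_eq_2_iff[OF wf]
      by (auto simp: arcs)
    moreover have "graph_dist G a u \<noteq> ereal 2"
      using aV unfolding graph_dist_eq_2_iff[OF wf] by (simp add: arcs)
    ultimately show ?thesis using verts by (auto simp: dist_nbhd_def)
  qed
  have nonempty: "V - W i \<noteq> {}" if i: "i \<in> {1..x}" for i
  proof -
    obtain k where k: "k \<in> {1..x}" "k \<noteq> i"
    proof (cases "i = 1")
      case True
      then show thesis using x by (intro that[of 2]) auto
    next
      case False
      then show thesis using x by (intro that[of 1]) auto
    qed
    then obtain b where "b \<in> W k" using ne by blast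
    then show ?thesis using k same[OF k(1) i] V by blast
  qed
  have "(\<forall>w\<in>pverts G. dist_nbhd G 2 w \<noteq> {} \<longrightarrow> sum f (dist_nbhd G 2 w) = M) \<longleftrightarrow>
    (\<forall>i\<in>{1..x}. sum f (V - W i) = M)"
  proof (intro iffI ballI impI)
    fix i assume *: "\<forall>w\<in>pverts G. dist_nbhd G 2 w \<noteq> {} \<longrightarrow> sum f (dist_nbhd G 2 w) = M"
      and i: "i \<in> {1..x}"
    then obtain a where a: "a \<in> W i" using ne by blast
    then have "a \<in> pverts G" using verts V i by blast
    then show "sum f (V - W i) = M" using * nbhd[OF i a] nonempty[OF i] by metis
  next
    fix w assume *: "\<forall>i\<in>{1..x}. sum f (V - W i) = M" and "w \<in> pverts G" "dist_nbhd G 2 w \<noteq> {}"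
    then have "w \<in> V" using verts nbhd_u by auto
    then obtain i where "i \<in> {1..x}" "w \<in> W i" using V by blast
    then show "sum f (dist_nbhd G 2 w) = M" using * nbhd by metis
  qed
  moreover have "\<exists>a\<in>pverts G. \<exists>b\<in>pverts G. graph_dist G a b = ereal 2"
  proof -
    have 1: "1 \<in> {1..x}" using x by simp
    then obtain a where a: "a \<in> W 1" using ne by blast
    then obtain b where "b \<in> dist_nbhd G 2 a" using nbhd[OF 1 a] nonempty[OF 1] by blast
    moreover have "a \<in> pverts G" using a 1 verts V by blast
    ultimately show ?thesis by (auto simp: dist_nbhd_def)
  qed
  ultimately show ?thesis
    unfolding distance_magic_labeling_def using card verts by auto
qed

text \<open>The second conjunct makes precise that \<open>u\<close> carries the omitted label
  \<open>j\<close>. It is proved first, for each \<open>j\<close>; the first conjunct then follows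
  by letting \<open>j\<close> vary.\<close>

theorem theorem4p1:
  fixes G H :: "'a pair_pre_digraph" and u :: 'a and v :: "nat \<Rightarrow> 'a"
    and m x :: nat and ms :: "nat \<Rightarrow> nat"
  assumes "3 \<le> m"
    and "long_brush m u v G"
    and "with_proj H = with_proj G \<restriction> v ` {1..m}"
    and "G = graph_join (graph_K1 u) H"
    and "graph_diameter G = 2"
    and "disjoint_union_of_complete x ms H"
    and "2 \<le> x"
    and "\<forall>i\<in>{1..x}. 1 \<le> ms i"
    and "mono_on {1..x} ms"
    and "(\<Sum>i=1..x. ms i) = m"
    and "3 \<le> ms 1 + ms 2"
  shows "(distance_magic 2 G \<longleftrightarrow>
            (\<exists>j\<in>{1..m+1}. \<exists>S. equal_sum_partition x ms ({1..m+1} - {j}) S)) \<and>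
         (\<forall>j\<in>{1..m+1}.
            (\<exists>f M. distance_magic_labeling 2 G f M \<and> f u = j) \<longleftrightarrow>
            (\<exists>S. equal_sum_partition x ms ({1..m+1} - {j}) S))"
proof -
  define V where "V = v ` {1..m}"
  have inj: "inj_on v {1..m}" and u: "u \<notin> V" and vertsG: "pverts G = insert u V"
    and "pair_graph G"
    using assms(2) by (auto simp: long_brush_def V_def)
  interpret pair_graph G by fact
  have wf: "pair_wf_digraph G" by unfold_locales
  have vertsH: "pverts H = V"
    using arg_cong[OF assms(3), of verts] by (simp add: V_def)
  obtain C where C: "\<And>i. i \<in> {1..x} \<Longrightarrow> K\<^bsub>ms i\<^esub> (with_proj (C i))"
    and disj: "disjoint_family_on (\<lambda>i. pverts (C i)) {1..x}"
    and H: "with_proj H = pre_digraph.Union (with_proj H) ((\<lambda>i. with_proj (C i)) ` {1..x})"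
    using assms(6) unfolding disjoint_union_of_complete_def by blast
  define W where "W i = pverts (C i)" for i
  have W: "finite (W i)" "card (W i) = ms i"
      "parcs (C i) = {(a, b). a \<in> W i \<and> b \<in> W i \<and> a \<noteq> b}" if "i \<in> {1..x}" for i
    using C[OF that] by (auto simp: complete_digraph_pair_def W_def)
  have disjW: "disjoint_family_on W {1..x}" using disj unfolding W_def .
  have V: "V = (\<Union>i\<in>{1..x}. W i)"
    using arg_cong[OF H, of verts] by (simp add: pre_digraph.Union_def vertsH W_def)
  have "parcs H = (\<Union>i\<in>{1..x}. parcs (C i))"
    using arg_cong[OF H, of arcs] by (simp add: pre_digraph.Union_def)
  then have "parcs H = (\<Union>i\<in>{1..x}. {(a, b). a \<in> W i \<and> b \<in> W i \<and> a \<noteq> b})"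
    using W(3) by simp
  then have arcsG: "parcs G = (\<Union>i\<in>{1..x}. {(a, b). a \<in> W i \<and> b \<in> W i \<and> a \<noteq> b}) \<union>
      {u} \<times> V \<union> V \<times> {u}"
    using arg_cong[OF assms(4), of parcs] by (simp add: graph_join_def graph_K1_def vertsH)
  have ne: "W i \<noteq> {}" if "i \<in> {1..x}" for i
    using W(2)[OF that] assms(8) that by force
  have cardG: "card (pverts G) = m + 1"
    using inj u by (simp add: vertsG) (simp add: V_def card_image)
  have lab: "distance_magic_labeling 2 G f M \<longleftrightarrow>
      bij_betw f (insert u V) {1..m+1} \<and> (\<forall>i\<in>{1..x}. sum f (V - W i) = M)" for f M
    using distance_magic_labeling_iff_clique_sums[OF wf vertsG arcsG V disjW ne u assms(7) cardG]
      assms(1) by simp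
  have main: "(\<exists>f M. distance_magic_labeling 2 G f M \<and> f u = j) \<longleftrightarrow>
      (\<exists>S. equal_sum_partition x ms ({1..m+1} - {j}) S)" (is "?L \<longleftrightarrow> ?R")
    if j: "j \<in> {1..m+1}" for j
  proof -
    \<comment> \<open>Once \<open>u\<close> has label \<open>j\<close>, the set
      \<open>{1..m+1} - {j}\<close> is what remains for \<open>V\<close>.\<close>
    have R: "?R \<longleftrightarrow> (\<exists>f M. bij_betw f V ({1..m+1} - {j}) \<and>
        (\<forall>i\<in>{1..x}. sum f (V - W i) = M))"
      using W assms(8) disjW V by (intro equal_sum_partition_iff_labeling) auto
    show ?thesis
    proof
      assume ?L
      then obtain f M where f: "bij_betw f (insert u V) {1..m+1}" "f u = j"
        and M: "\<forall>i\<in>{1..x}. sum f (V - W i) = M" unfolding lab by blast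
      have "bij_betw f V ({1..m+1} - {j})"
        using notIn_Un_bij_betw3[of u V f "{1..m+1} - {j}"] f u j
        by (simp add: insert_absorb)
      then show ?R unfolding R using M by blast
    next
      assume ?R
      then obtain f M where f: "bij_betw f V ({1..m+1} - {j})"
        and M: "\<forall>i\<in>{1..x}. sum f (V - W i) = M" unfolding R by blast
      \<comment> \<open>The bijection on \<open>V\<close> says nothing about its value at
        \<open>u\<close>. Setting it to \<open>j\<close> leaves all sums over subsets of
        \<open>V\<close> unchanged.\<close>
      let ?f = "f(u := j)"
      have "bij_betw ?f V ({1..m+1} - {j})"
        using f u by (subst bij_betw_cong[of V ?f f]) auto
      then have "bij_betw ?f (insert u V) {1..m+1}"
        using notIn_Un_bij_betw3[of u V ?f "{1..m+1} - {j}"] u j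
        by (simp add: insert_absorb)
      moreover have "sum ?f (V - W i) = sum f (V - W i)" for i
        using u by (intro sum.cong) auto
      ultimately have "distance_magic_labeling 2 G ?f M"
        unfolding lab using M by simp
      then show ?L by (intro exI[of _ ?f] exI[of _ M]) simp
    qed
  qed
  \<comment> \<open>Every labeling is thus covered by some admissible \<open>j\<close>, namely
    \<open>f u\<close>.\<close>
  moreover have "f u \<in> {1..m+1}" if "distance_magic_labeling 2 G f M" for f M
    using that unfolding lab by (auto dest: bij_betw_apply)
  ultimately show ?thesis unfolding distance_magic_def by blast
qed

end
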